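(* Let $q\ge 1$ be an integer and let $T$ be an infinite $(q+1)$-homogeneous tree rooted at $o$. For $0<r<s\le\infty$, we have $\mathbb{T}_s\subset\mathbb{T}_r$ and $\mathbb{T}_{s,0}\subset\mathbb{T}_{r,0}$ (inclusions not asserted to be strict).
   Context: A $(q+1)$-homogeneous tree is a connected graph without cycles in which every vertex has exactly $q+1$ neighbours; rooted means that a vertex $o$ (the root) is singled out. For a vertex $v$, $|v|$ is the number of edges in the unique path from $o$ to $v$; for $n\ge1$ there are $(q+1)q^{n-1}$ vertices with $|v|=n$. Functions on $T$ are functions on its vertices. $\mathbb{N}=\{1,2,\dots\}$, $\mathbb{N}_0=\mathbb{N}\cup\{0\}$. For $f\colon T\to\mathbb{C}$ and $n\in\mathbb{N}$, $M_p(n,f)=\left(\frac{1}{(q+1)q^{n-1}}\sum_{|v|=n}|f(v)|^p\right)^{1/p}$ if $0<p<\infty$, $M_\infty(n,f)=\max_{|v|=n}|f(v)|$, and $M_p(0,f)=|f(o)|$ for all $p\in(0,\infty]$. Put $\|f\|_p=\sup_{n\in\mathbb{N}_0}M_p(n,f)$, $\mathbb{T}_p=\{f\colon T\to\mathbb{C}:\|f\|_p<\infty\}$ and $\mathbb{T}_{p,0}=\{f\in\mathbb{T}_p:\lim_{n\to\infty}M_p(n,f)=0\}$. *)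

theory Defs
  imports
    "HOL-Analysis.Analysis"
    "Graph_Theory.Digraph_Component"
begin

text \<open>
  A simple undirected graph, possibly infinite, is a symmetric loop-free arc relation. The
  constants \<open>forest\<close> and \<open>tree\<close> of \<open>Digraph_Component\<close> do not fit: every edge of a symmetric
  digraph gives a directed cycle of length 2. With symmetric arcs, the cycles of an undirected
  graph are the directed cycles of length at least 3.
\<close>

definition homogeneous_tree :: "nat \<Rightarrow> 'a pair_pre_digraph \<Rightarrow> bool" where
  "homogeneous_tree d T \<longleftrightarrow>
     pair_bidirected_digraph T \<and>
     Digraph_Component.connected (with_proj T) \<and>
     \<not> (\<exists>c. pre_digraph.cycle (with_proj T) c \<and> 3 \<le> length c) \<and>
     (\<forall>v\<in>pverts T. out_degree (with_proj T) v = d)"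

text \<open>
  A path is the list of its arcs, so its length is its number of edges.
\<close>

definition level :: "'a pair_pre_digraph \<Rightarrow> 'a \<Rightarrow> 'a \<Rightarrow> nat" where
  "level T rt v = length (THE p. pre_digraph.apath (with_proj T) rt p v)"

definition level_set :: "'a pair_pre_digraph \<Rightarrow> 'a \<Rightarrow> nat \<Rightarrow> 'a set" where
  "level_set T rt n = {v \<in> pverts T. level T rt v = n}"

text \<open>
  The exponent \<open>p\<close> ranges over \<open>0 < p \<le> \<infinity>\<close>; values for other \<open>p\<close> are meaningless.
\<close>

definition M_mean ::
    "nat \<Rightarrow> 'a pair_pre_digraph \<Rightarrow> 'a \<Rightarrow> ereal \<Rightarrow> nat \<Rightarrow> ('a \<Rightarrow> complex) \<Rightarrow> real" where
  "M_mean q T rt p n f =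
     (if n = 0 then cmod (f rt)
      else if p = \<infinity> then Max ((\<lambda>v. cmod (f v)) ` level_set T rt n)
      else (1 / ((real q + 1) * real q ^ (n - 1)) *
             (\<Sum>v\<in>level_set T rt n. cmod (f v) powr real_of_ereal p))
           powr (1 / real_of_ereal p))"

definition T_norm ::
    "nat \<Rightarrow> 'a pair_pre_digraph \<Rightarrow> 'a \<Rightarrow> ereal \<Rightarrow> ('a \<Rightarrow> complex) \<Rightarrow> ereal" where
  "T_norm q T rt p f = (SUP n. ereal (M_mean q T rt p n f))"

text \<open>
  Extensionality makes the elements correspond one-to-one to functions on the vertices of \<open>T\<close>.
\<close>

definition T_space ::
    "nat \<Rightarrow> 'a pair_pre_digraph \<Rightarrow> 'a \<Rightarrow> ereal \<Rightarrow> ('a \<Rightarrow> complex) set" where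
  "T_space q T rt p = {f \<in> extensional (pverts T). T_norm q T rt p f < \<infinity>}"

definition T_space0 ::
    "nat \<Rightarrow> 'a pair_pre_digraph \<Rightarrow> 'a \<Rightarrow> ereal \<Rightarrow> ('a \<Rightarrow> complex) set" where
  "T_space0 q T rt p =
     {f \<in> T_space q T rt p. (\<lambda>n. M_mean q T rt p n f) \<longlonglongrightarrow> 0}"

end

theory Submission
  imports Defs
begin

text \<open>
  Acyclicity makes simple paths unique, so a vertex of level \<open>n\<close> is the end of a simple path of
  length \<open>n\<close> from the root, and there are at most \<open>N = (q + 1) q\<^sup>n\<^sup>-\<^sup>1\<close> of these. Hence \<open>M\<^sub>p(n, f)\<close> is a
  power mean of at most \<open>N\<close> numbers, padded with zeros, and power means increase with the exponent.
\<close>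

section \<open>Simple paths and the size of a level\<close>

text \<open>Induction on the first path. If both paths leave \<open>u\<close> by the same arc, the
  tails agree by induction. Otherwise the tails join two distinct neighbours of \<open>u\<close>
  while avoiding \<open>u\<close>, and closing up through \<open>u\<close> yields a forbidden
  cycle.\<close>

lemma (in pair_sym_digraph) acyclic_apath_unique:
  assumes acyclic: "\<not> (\<exists>c. cycle c \<and> 3 \<le> length c)"
    and "apath u p v" and "apath u q v"
  shows "p = q"
  using assms(2,3)
proof (induction p arbitrary: u q)
  case Nil
  then show ?case
    by (metis apath_Nil_iff apath_nonempty_ends)
next
  case (Cons e es)
  then have "u \<noteq> v"
    by (metis apath_nonempty_ends list.distinct(1))
  then obtain f fs where q: "q = f # fs"
    using Cons.prems(2) by (cases q) (auto simp: apath_Nil_iff)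
  have e: "e \<in> parcs G" "fst e = u" "apath (snd e) es v" "u \<notin> set (awalk_verts (snd e) es)"
    using Cons.prems(1) by (auto simp: apath_Cons_iff)
  have f: "f \<in> parcs G" "fst f = u" "apath (snd f) fs v" "u \<notin> set (awalk_verts (snd f) fs)"
    using Cons.prems(2) by (auto simp: q apath_Cons_iff)
  show ?case
  proof (cases "snd e = snd f")
    case True
    then show ?thesis
      using e f Cons.IH q by (metis prod.collapse)
  next
    case False
    \<comment> \<open>\<open>w\<close> runs from \<open>snd e\<close> through \<open>v\<close> back
      to \<open>snd f\<close>. It may repeat vertices, since the tails can meet before
      \<open>v\<close>; \<open>r\<close> is a simple path extracted from it.\<close>
    define w where "w = es @ rev_path fs"
    define r where "r = awalk_to_apath w"
    have rev: "awalk v (rev_path fs) (snd f)"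
      using f(3) by (simp add: awalkI_apath)
    have es: "awalk (snd e) es v"
      using e(3) by (rule awalkI_apath)
    have w: "awalk (snd e) w (snd f)"
      unfolding w_def using es rev by (rule awalk_appendI)
    have "u \<notin> set (awalk_verts (snd e) w)"
      using es rev e(4) f(3,4) w
      by (simp add: w_def set_awalk_verts_append awalk_verts_rev_path[OF awalkI_apath])
    then have u_w: "u \<noteq> snd e \<and> u \<notin> fst ` set w \<and> u \<notin> snd ` set w"
      using set_awalk_verts[OF w] by auto
    have r: "apath (snd e) r (snd f)"
      unfolding r_def using w by (rule apath_awalk_to_apath)
    have "set r \<subseteq> set w"
      unfolding r_def using w by (rule awalk_to_apath_subset)
    then have u_r: "u \<notin> set (awalk_verts (snd e) r)"
      using set_awalk_verts[OF awalkI_apath[OF r]] u_w by auto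
    \<comment> \<open>With at least one arc in \<open>r\<close>, the closed walk \<open>e\<close>,
      \<open>r\<close>, \<open>(snd f, u)\<close> has length at least 3.\<close>
    have "r \<noteq> []"
      using r False by (auto simp: apath_Nil_iff)
    have f_rev: "(snd f, u) \<in> parcs G"
      using f(1,2) by (metis arcs_symmetric prod.collapse)
    have walk: "awalk (snd e) (r @ [(snd f, u)]) u"
      using awalkI_apath[OF r] f_rev by (auto simp: awalk_simps in_arcsD2)
    have verts: "awalk_verts (snd e) (r @ [(snd f, u)]) = awalk_verts (snd e) r @ [u]"
      using walk awalkI_apath[OF r] by (simp add: awalk_verts_append)
    have "cycle (e # r @ [(snd f, u)])"
      unfolding cycle_def
    proof (intro exI conjI)
      show "awalk u (e # r @ [(snd f, u)]) u"
        unfolding awalk_Cons_iff using walk e(1,2) by blast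
      show "distinct (tl (awalk_verts u (e # r @ [(snd f, u)])))"
        using r u_r verts by (simp add: apath_def)
    qed simp
    moreover have "3 \<le> length (e # r @ [(snd f, u)])"
      using \<open>r \<noteq> []\<close> by (cases r) auto
    ultimately show ?thesis
      using acyclic by blast
  qed
qed

text \<open>There are \<open>q + 1\<close> choices for the first arc and at most \<open>q\<close>
  for each later one, because a simple path never turns back along the arc just used.\<close>

lemma (in pair_sym_digraph) regular_card_apaths_le:
  fixes rt :: 'a
  defines "P \<equiv> \<lambda>n. {p. (\<exists>v. apath rt p v) \<and> length p = n}"
  assumes regular: "\<And>v. v \<in> pverts G \<Longrightarrow> out_degree (with_proj G) v = q + 1"
  shows "finite (P (Suc n)) \<and> card (P (Suc n)) \<le> (q + 1) * q ^ n"
proof -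
  \<comment> \<open>\<open>out_degree\<close> is a \<open>card\<close>, which is 0 on infinite sets,
    so the positive value \<open>q + 1\<close> forces finiteness.\<close>
  have fin: "finite (out_arcs (with_proj G) v)" "card (out_arcs (with_proj G) v) = q + 1"
    if "v \<in> pverts G" for v
    using regular[OF that] by (auto simp: out_degree_def intro: card_ge_0_finite)
  show ?thesis
  proof (induction n)
    case 0
    show ?case
    proof (cases "rt \<in> pverts G")
      case True
      have "P (Suc 0) \<subseteq> (\<lambda>e. [e]) ` out_arcs (with_proj G) rt"
        by (auto simp: P_def length_Suc_conv apath_Cons_iff)
      moreover have "card ((\<lambda>e. [e]) ` out_arcs (with_proj G) rt) \<le> q + 1"
        using card_image_le[OF fin(1)[OF True], of "\<lambda>e. [e]"] fin(2)[OF True] by simp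
      moreover have "finite ((\<lambda>e. [e]) ` out_arcs (with_proj G) rt)"
        using fin(1)[OF True] by simp
      ultimately have "finite (P (Suc 0)) \<and> card (P (Suc 0)) \<le> q + 1"
        by (meson card_mono finite_subset order_trans)
      then show ?thesis by simp
    next
      case False
      then have "P (Suc 0) = {}"
        by (auto simp: P_def apath_def awalk_def)
      then show ?thesis by simp
    qed
  next
    case (Suc n)
    \<comment> \<open>The candidates for the next arc: all arcs leaving the end of \<open>p\<close>
      except the reverse of its last arc, which is among them by symmetry.\<close>
    define X where "X p = out_arcs (with_proj G) (snd (last p)) - {prod.swap (last p)}" for p
    have X: "finite (X p) \<and> card (X p) = q" if "p \<in> P (Suc n)" for p
    proof -
      have "p \<noteq> []" "set p \<subseteq> parcs G"
        using that by (auto simp: P_def apath_def awalk_def)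
      then have "last p \<in> parcs G"
        using last_in_set by blast
      then have "snd (last p) \<in> pverts G" "prod.swap (last p) \<in> out_arcs (with_proj G) (snd (last p))"
        by (auto simp: in_arcsD2 arc_snd_in_verts prod.swap_def intro: arcs_symmetric)
      then show ?thesis
        using fin by (simp add: X_def)
    qed
    have "P (Suc (Suc n)) \<subseteq> (\<Union>p\<in>P (Suc n). (\<lambda>e. p @ [e]) ` X p)"
    proof
      fix p' assume "p' \<in> P (Suc (Suc n))"
      then obtain v where v: "apath rt p' v" and len: "length p' = Suc (Suc n)"
        by (auto simp: P_def)
      then obtain p e where p': "p' = p @ [e]"
        by (metis length_0_conv nat.distinct(1) rev_exhaust)
      then have "length p = Suc n" using len by simp
      then obtain p0 d where p: "p = p0 @ [d]"
        by (metis length_0_conv nat.distinct(1) rev_exhaust)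
      have "apath rt p (awlast rt p)" "apath (awlast rt p) [e] v"
        using v by (auto simp: p' apath_append_iff)
      then have *: "p \<in> P (Suc n)" "e \<in> parcs G" "fst e = snd d"
        using \<open>length p = Suc n\<close> by (auto simp: P_def p apath_Cons_iff awlast_append)
      \<comment> \<open>The last two arcs alone form a simple path, so \<open>e\<close> cannot lead
        back to the start of \<open>d\<close>.\<close>
      have "apath (awlast rt p0) [d, e] v"
        using v by (simp add: p' p apath_append_iff)
      then have "e \<noteq> prod.swap d"
        by (auto simp: apath_simps)
      then have "e \<in> X p"
        using * p by (simp add: X_def)
      then show "p' \<in> (\<Union>p\<in>P (Suc n). (\<lambda>e. p @ [e]) ` X p)"
        using *(1) p' by blast
    qed
    moreover have "finite (\<Union>p\<in>P (Suc n). (\<lambda>e. p @ [e]) ` X p)"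
      using Suc X by blast
    moreover have "card (\<Union>p\<in>P (Suc n). (\<lambda>e. p @ [e]) ` X p) \<le> (q + 1) * q ^ Suc n"
    proof -
      have "card (\<Union>p\<in>P (Suc n). (\<lambda>e. p @ [e]) ` X p) \<le> (\<Sum>p\<in>P (Suc n). card ((\<lambda>e. p @ [e]) ` X p))"
        using Suc by (intro card_UN_le) simp
      also have "\<dots> \<le> (\<Sum>p\<in>P (Suc n). q)"
        using X by (intro sum_mono) (metis card_image_le)
      also have "\<dots> \<le> (q + 1) * q ^ Suc n"
        using Suc mult_le_mono1[of "card (P (Suc n))" "(q + 1) * q ^ n" q] by (simp add: mult_ac)
      finally show ?thesis .
    qed
    ultimately show ?case
      by (meson card_mono finite_subset order_trans)
  qed
qed

text \<open>Every vertex of the level is the end of a simple path counted in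
  \<open>regular_card_apaths_le\<close>, so the path count bounds the level.\<close>

lemma card_level_set_le:
  assumes "homogeneous_tree (q + 1) T" and "rt \<in> pverts T"
  shows "finite (level_set T rt (Suc n)) \<and> card (level_set T rt (Suc n)) \<le> (q + 1) * q ^ n"
proof -
  interpret pair_bidirected_digraph T
    using assms(1) by (simp add: homogeneous_tree_def)
  have acyclic: "\<not> (\<exists>c. cycle c \<and> 3 \<le> length c)"
    and conn: "Digraph_Component.connected (with_proj T)"
    and regular: "\<And>v. v \<in> pverts T \<Longrightarrow> out_degree (with_proj T) v = q + 1"
    using assms(1) by (auto simp: homogeneous_tree_def)
  define P where "P = {p. (\<exists>v. apath rt p v) \<and> length p = Suc n}"
  have P: "finite P" "card P \<le> (q + 1) * q ^ n"
    using regular_card_apaths_le[OF regular, where rt = rt] by (auto simp: P_def)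
  have "level_set T rt (Suc n) \<subseteq> awlast rt ` P"
  proof
    fix v assume "v \<in> level_set T rt (Suc n)"
    then have v: "v \<in> pverts T" and level: "level T rt v = Suc n"
      by (auto simp: level_set_def)
    \<comment> \<open>\<open>connected\<close> speaks of the symmetric closure; reachability there
      agrees with reachability in \<open>T\<close> because the arcs of \<open>T\<close> are
      symmetric.\<close>
    have "rt \<rightarrow>\<^sup>*\<^bsub>with_proj T\<^esub> v"
      using conn v assms(2) reachable_mk_symmetric_eq[OF sym_arcs]
      unfolding Digraph_Component.connected_def strongly_connected_def by simp
    then obtain p where p: "apath rt p v"
      by (auto simp: reachable_apath)
    then have "(THE p. apath rt p v) = p"
      using acyclic_apath_unique[OF acyclic] by blast
    then have "length p = Suc n"
      using level by (simp add: level_def)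
    moreover have "awlast rt p = v"
      using p by (auto simp: apath_def)
    ultimately show "v \<in> awlast rt ` P"
      using p by (auto simp: P_def)
  qed
  then show ?thesis
    using P by (meson finite_imageI finite_subset order_trans card_image_le card_mono)
qed

section \<open>Power means\<close>

text \<open>Jensen's inequality for the concave map \<open>y powr t\<close> with
  \<open>t = r / s\<close>, in tangent form. The values are normalised to
  \<open>y = a x powr s / A\<close>, which sum to \<open>N\<close>; points missing from
  \<open>L\<close> count as zeros.\<close>

lemma power_mean_mono:
  fixes a :: "'b \<Rightarrow> real"
  assumes "finite L" and card: "real (card L) \<le> N" and "0 < N"
    and nonneg: "\<And>x. x \<in> L \<Longrightarrow> 0 \<le> a x" and "0 < r" and "r < s"
  shows "(1 / N * (\<Sum>x\<in>L. a x powr r)) powr (1 / r) \<le> (1 / N * (\<Sum>x\<in>L. a x powr s)) powr (1 / s)"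
proof (cases "\<forall>x\<in>L. a x = 0")
  case True
  then show ?thesis
    using assms by simp
next
  case False
  then have pos: "0 < (\<Sum>x\<in>L. a x powr s)"
    using \<open>finite L\<close> by (force intro: sum_pos2)
  define A where "A = 1 / N * (\<Sum>x\<in>L. a x powr s)"
  have "0 < A"
    using pos \<open>0 < N\<close> by (simp add: A_def)
  define t where "t = r / s"
  have t: "0 < t" "t < 1" "s * t = r"
    using assms(5,6) by (auto simp: t_def)
  \<comment> \<open>The line \<open>t * y + (1 - t)\<close> is the tangent of
    \<open>y powr t\<close> at 1. It lies above by Young's inequality with second factor 1, which
    requires \<open>y > 0\<close>; hence the separate case \<open>a x = 0\<close>.\<close>
  have tangent: "a x powr r \<le> A powr t * (t * (a x powr s / A) + (1 - t))" if "x \<in> L" for x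
  proof (cases "a x = 0")
    case True
    then show ?thesis using t by simp
  next
    case False
    then have "0 < a x powr s / A"
      using \<open>0 < A\<close> by simp
    from Youngs_inequality_0[OF _ _ _ this, of t "1 - t" 1] t
    have "(a x powr s / A) powr t \<le> t * (a x powr s / A) + (1 - t)"
      by simp
    moreover have "(a x powr s / A) powr t = a x powr r / A powr t"
      using \<open>0 < A\<close> t by (simp add: powr_divide powr_powr)
    ultimately show ?thesis
      using \<open>0 < A\<close> by (simp add: pos_divide_le_eq mult.commute)
  qed
  have "1 / N * (\<Sum>x\<in>L. a x powr r) \<le> 1 / N * (\<Sum>x\<in>L. A powr t * (t * (a x powr s / A) + (1 - t)))"
    using tangent \<open>0 < N\<close> by (intro mult_left_mono sum_mono) auto
  also have "\<dots> = A powr t * (t + (1 - t) * (real (card L) / N))"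
  proof -
    have "(\<Sum>x\<in>L. a x powr s) = N * A"
      using \<open>0 < N\<close> by (simp add: A_def)
    then have "(\<Sum>x\<in>L. t * (a x powr s / A) + (1 - t)) = t * N + real (card L) * (1 - t)"
      using \<open>0 < A\<close>
      by (simp add: sum.distrib flip: sum_distrib_left sum_divide_distrib)
    then have "(\<Sum>x\<in>L. A powr t * (t * (a x powr s / A) + (1 - t))) =
        A powr t * (t * N + real (card L) * (1 - t))"
      by (simp only: flip: sum_distrib_left)
    then show ?thesis
      using \<open>0 < N\<close> by (simp add: field_simps)
  qed
  \<comment> \<open>The linear terms already average to \<open>t\<close>;
    \<open>card L \<le> N\<close> bounds the contribution of the constant terms by
    \<open>1 - t\<close>.\<close>
  also have "\<dots> \<le> A powr t * 1"
  proof (intro mult_left_mono)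
    show "t + (1 - t) * (real (card L) / N) \<le> 1"
      using mult_left_mono[of "real (card L) / N" 1 "1 - t"] t card \<open>0 < N\<close> by simp
  qed simp
  finally have "(1 / N * (\<Sum>x\<in>L. a x powr r)) powr (1 / r) \<le> (A powr t) powr (1 / r)"
    using assms by (intro powr_mono2) (auto intro!: divide_nonneg_nonneg sum_nonneg)
  also have "\<dots> = A powr (1 / s)"
    using assms(5,6) by (simp add: powr_powr t_def)
  finally show ?thesis
    by (simp add: A_def)
qed

text \<open>The endpoint \<open>s = \<infinity>\<close> of the monotonicity: at most
  \<open>N\<close> terms, each at most \<open>B powr r\<close>. A general \<open>B\<close> allows
  the maximum to be cut off below at 0.\<close>

lemma power_mean_le_bound:
  fixes a :: "'b \<Rightarrow> real"
  assumes card: "real (card L) \<le> N" and "0 < N"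
    and bound: "\<And>x. x \<in> L \<Longrightarrow> 0 \<le> a x \<and> a x \<le> B" and "0 \<le> B" and "0 < r"
  shows "(1 / N * (\<Sum>x\<in>L. a x powr r)) powr (1 / r) \<le> B"
proof -
  have "(\<Sum>x\<in>L. a x powr r) \<le> real (card L) * B powr r"
    using bound \<open>0 < r\<close> by (intro sum_bounded_above powr_mono2) auto
  also have "\<dots> \<le> N * B powr r"
    using card by (intro mult_right_mono) auto
  finally have "1 / N * (\<Sum>x\<in>L. a x powr r) \<le> B powr r"
    using \<open>0 < N\<close> by (simp add: field_simps)
  then have "(1 / N * (\<Sum>x\<in>L. a x powr r)) powr (1 / r) \<le> (B powr r) powr (1 / r)"
    using assms by (intro powr_mono2) (auto intro!: divide_nonneg_nonneg sum_nonneg)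
  also have "\<dots> = B"
    using \<open>0 \<le> B\<close> \<open>0 < r\<close> by (simp add: powr_powr)
  finally show ?thesis .
qed

section \<open>Comparison of the means and of the spaces\<close>

text \<open>
  The maximum with \<open>0\<close> covers the junk value \<open>Max {}\<close>, so that no level has to be shown nonempty.
\<close>

lemma M_mean_mono:
  assumes "q \<ge> 1" and "homogeneous_tree (q + 1) T" and "rt \<in> pverts T"
    and "0 < r" and "r < s"
  shows "M_mean q T rt r n f \<le> max 0 (M_mean q T rt s n f)"
proof (cases n)
  case 0
  then show ?thesis by (simp add: M_mean_def)
next
  case (Suc m)
  define L where "L = level_set T rt n"
  define N where "N = (real q + 1) * real q ^ m"
  have "finite L" "card L \<le> (q + 1) * q ^ m"
    using card_level_set_le[OF assms(2,3)] by (auto simp: L_def Suc)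
  then have "real (card L) \<le> real ((q + 1) * q ^ m)"
    by (simp only: of_nat_le_iff)
  then have card: "real (card L) \<le> N"
    by (simp add: N_def algebra_simps)
  have "0 < N"
    using assms(1) by (simp add: N_def)
  \<comment> \<open>\<open>r < s\<close> makes \<open>r\<close> finite even when
    \<open>s = \<infinity>\<close>.\<close>
  obtain r' where r: "r = ereal r'" "0 < r'"
    using assms(4,5) by (cases r) auto
  have M_r: "M_mean q T rt r n f = (1 / N * (\<Sum>v\<in>L. cmod (f v) powr r')) powr (1 / r')"
    by (simp add: M_mean_def Suc N_def L_def r)
  show ?thesis
  proof (cases "s = \<infinity>")
    case True
    then have M_s: "M_mean q T rt s n f = Max ((\<lambda>v. cmod (f v)) ` L)"
      by (simp add: M_mean_def Suc L_def)
    have "cmod (f v) \<le> max 0 (M_mean q T rt s n f)" if "v \<in> L" for v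
      using Max_ge[of "(\<lambda>v. cmod (f v)) ` L" "cmod (f v)"] that \<open>finite L\<close> unfolding M_s
      by (simp add: le_max_iff_disj)
    then show ?thesis
      unfolding M_r using card \<open>0 < N\<close> r(2) by (intro power_mean_le_bound) auto
  next
    case False
    then obtain s' where s: "s = ereal s'" "r' < s'"
      using assms(5) r by (cases s) auto
    have "M_mean q T rt s n f = (1 / N * (\<Sum>v\<in>L. cmod (f v) powr s')) powr (1 / s')"
      by (simp add: M_mean_def Suc N_def L_def s)
    then show ?thesis
      unfolding M_r using power_mean_mono[OF \<open>finite L\<close> card \<open>0 < N\<close> _ r(2) s(2), of "\<lambda>v. cmod (f v)"]
      by simp
  qed
qed

text \<open>The lower half of the squeeze for the limits. A finite exponent avoids
  \<open>Max {}\<close>, whose sign is unknown.\<close>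

lemma M_mean_nonneg:
  assumes "0 < r" and "r < \<infinity>"
  shows "0 \<le> M_mean q T rt r n f"
  using assms by (simp add: M_mean_def)

theorem theorem3:
  fixes q :: nat and T :: "'a pair_pre_digraph" and rt :: 'a and r s :: ereal
  assumes "q \<ge> 1"
    and "homogeneous_tree (q + 1) T"
    and "infinite (pverts T)"
    and "rt \<in> pverts T"
    and "0 < r" and "r < s" and "s \<le> \<infinity>"
  shows "T_space q T rt s \<subseteq> T_space q T rt r \<and> T_space0 q T rt s \<subseteq> T_space0 q T rt r"
proof -
  have mono: "M_mean q T rt r n f \<le> max 0 (M_mean q T rt s n f)" for n f
    by (rule M_mean_mono[OF assms(1,2,4,5,6)])
  have "r < \<infinity>"
    using assms by (metis ereal_infty_less(1) less_ereal.simps(2) order_less_le_trans)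
  then have nonneg: "0 \<le> M_mean q T rt r n f" for n f
    using assms(5) by (intro M_mean_nonneg)
  have space: "f \<in> T_space q T rt r" if "f \<in> T_space q T rt s" for f
  proof -
    \<comment> \<open>The cut-off at 0 does no harm: the maximum of 0 and a supremum below
      \<open>\<infinity>\<close> is still below \<open>\<infinity>\<close>.\<close>
    have "T_norm q T rt r f \<le> max 0 (T_norm q T rt s f)"
      unfolding T_norm_def
    proof (rule SUP_least)
      fix n
      have "ereal (M_mean q T rt r n f) \<le> max 0 (ereal (M_mean q T rt s n f))"
        using mono[of n f] by (auto simp: max_def split: if_splits)
      also have "\<dots> \<le> max 0 (SUP n. ereal (M_mean q T rt s n f))"
        by (intro max.mono SUP_upper) auto
      finally show "ereal (M_mean q T rt r n f) \<le> max 0 (SUP n. ereal (M_mean q T rt s n f))" .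
    qed
    then show ?thesis
      using that by (auto simp: T_space_def max_def split: if_splits)
  qed
  moreover have "(\<lambda>n. M_mean q T rt r n f) \<longlonglongrightarrow> 0" if "(\<lambda>n. M_mean q T rt s n f) \<longlonglongrightarrow> 0" for f
  \<comment> \<open>Squeeze between the constant 0 and the cut-off mean, which tends to
    \<open>max 0 0 = 0\<close>.\<close>
  proof (rule tendsto_sandwich[OF _ _ tendsto_const])
    show "(\<lambda>n. max 0 (M_mean q T rt s n f)) \<longlonglongrightarrow> 0"
      using tendsto_max[OF tendsto_const that, of 0] by simp
  qed (use mono nonneg in auto)
  ultimately show ?thesis
    by (auto simp: T_space0_def)
qed

end
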